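(* Let $\lambda\in C^1(\mathbb{R};(0,+\infty))$. For every $k\in(-1,1)$ and every $R>0$, there exist constants $C=C(k,R)>0$ and $\alpha=\alpha(k,R)>0$ such that, for any $\rho_0\in L^2(0,1)$ with $$\|\rho_0\|_{L^1(0,1)}\le R,$$ the weak solution $\rho\in C^0([0,+\infty);L^2(0,1))$ of the Cauchy problem $$ \begin{cases} \rho_t(t,x)+(\rho(t,x)\lambda(W(t)))_x=0, & t\in(0,+\infty),\ x\in(0,1),\\ \rho(0,x)=\rho_0(x), & x\in(0,1),\\ u(t)=k\,y(t), & t\in(0,+\infty), \end{cases} $$ where $W(t)=\int_0^1\rho(t,x)\,dx$, $u(t)=\rho(t,0)\lambda(W(t))$ and $y(t)=\rho(t,1)\lambda(W(t))$, satisfies $$\|\rho(t,\cdot)\|_{L^2(0,1)}\le C e^{-\alpha t}\|\rho_0\|_{L^2(0,1)},\qquad\forall t\in[0,+\infty).$$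
   Context: The function $\lambda$ is fixed throughout; the constants $C,\alpha$ may depend on it. A weak solution of the Cauchy problem is a function $\rho\in C^0([0,+\infty);L^2(0,1))$ for which there is a function $y\in L^2_{loc}([0,+\infty))$ (the outflux, representing $\rho(t,1)\lambda(W(t))$) such that, with $W(t)=\int_0^1\rho(t,x)\,dx$, for every $\tau>0$ and every $\varphi\in C^1([0,\tau]\times[0,1])$ with $\varphi(\tau,x)=0$ for all $x\in[0,1]$, $$-\int_0^\tau\!\!\int_0^1\rho(t,x)\big(\varphi_t(t,x)+\lambda(W(t))\varphi_x(t,x)\big)\,dx\,dt-\int_0^1\rho_0(x)\varphi(0,x)\,dx+\int_0^\tau\big(y(t)\varphi(t,1)-k\,y(t)\varphi(t,0)\big)\,dt=0.$$ *)

theory Defs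
  imports "HOL-Analysis.Analysis"
begin

text \<open>
  Elements of \<open>L\<^sup>2\<close> are handled through representatives: a class is a function that is Lebesgue
  measurable and square integrable on the given set.
\<close>

definition in_L2 :: "real set \<Rightarrow> (real \<Rightarrow> real) \<Rightarrow> bool" where
  "in_L2 S f \<longleftrightarrow>
     set_borel_measurable lebesgue S f \<and> set_integrable lebesgue S (\<lambda>x. (f x)\<^sup>2)"

definition L2_norm_on :: "real set \<Rightarrow> (real \<Rightarrow> real) \<Rightarrow> real" where
  "L2_norm_on S f = sqrt (LINT x:S|lebesgue. (f x)\<^sup>2)"

text \<open>On \<open>{0<..<1}\<close>, \<open>in_L2\<close> implies integrability, so this is the true norm there.\<close>

definition L1_norm_on :: "real set \<Rightarrow> (real \<Rightarrow> real) \<Rightarrow> real" where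
  "L1_norm_on S f = (LINT x:S|lebesgue. \<bar>f x\<bar>)"

definition L2_loc_halfline :: "(real \<Rightarrow> real) \<Rightarrow> bool" where
  "L2_loc_halfline y \<longleftrightarrow> (\<forall>T>0. in_L2 {0..T} y)"

text \<open>\<open>\<rho> \<in> C\<^sup>0([0,\<infinity>); L\<^sup>2(0,1))\<close>; values \<open>\<rho> t\<close> for \<open>t < 0\<close> are irrelevant.\<close>

definition continuous_L2 :: "(real \<Rightarrow> real \<Rightarrow> real) \<Rightarrow> bool" where
  "continuous_L2 \<rho> \<longleftrightarrow>
     (\<forall>t\<ge>0. in_L2 {0<..<1} (\<rho> t)) \<and>
     (\<forall>t\<ge>0. ((\<lambda>s. L2_norm_on {0<..<1} (\<lambda>x. \<rho> s x - \<rho> t x)) \<longlongrightarrow> 0) (at t within {0..}))"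

text \<open>
  \<open>\<phi> \<in> C\<^sup>1([0,\<tau>] \<times> [0,1])\<close> with partial derivatives \<open>\<phi>t\<close> and \<open>\<phi>x\<close>, which are one-sided on the
  boundary and uniquely determined on the rectangle when \<open>\<tau> > 0\<close>.
\<close>

definition C1_on_rectangle ::
  "real \<Rightarrow> (real \<Rightarrow> real \<Rightarrow> real) \<Rightarrow> (real \<Rightarrow> real \<Rightarrow> real) \<Rightarrow> (real \<Rightarrow> real \<Rightarrow> real) \<Rightarrow> bool"
where
  "C1_on_rectangle \<tau> \<phi> \<phi>t \<phi>x \<longleftrightarrow>
     continuous_on ({0..\<tau>} \<times> {0..1}) (\<lambda>(t, x). \<phi> t x) \<and>
     continuous_on ({0..\<tau>} \<times> {0..1}) (\<lambda>(t, x). \<phi>t t x) \<and>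
     continuous_on ({0..\<tau>} \<times> {0..1}) (\<lambda>(t, x). \<phi>x t x) \<and>
     (\<forall>t\<in>{0..\<tau>}. \<forall>x\<in>{0..1}.
        ((\<lambda>s. \<phi> s x) has_real_derivative \<phi>t t x) (at t within {0..\<tau>}) \<and>
        ((\<lambda>z. \<phi> t z) has_real_derivative \<phi>x t x) (at x within {0..1}))"

definition total_mass :: "(real \<Rightarrow> real \<Rightarrow> real) \<Rightarrow> real \<Rightarrow> real" where
  "total_mass \<rho> t = (LINT x:{0<..<1}|lebesgue. \<rho> t x)"

text \<open>
  The velocity is \<open>lam\<close>. The space-time integral is an iterated one: \<open>\<rho>\<close> is a curve in \<open>L\<^sup>2\<close>, so a
  choice of representatives need not be jointly measurable, while the inner integral is always a
  continuous function of \<open>t\<close>, independent of that choice. The boundary law \<open>u = k y\<close> enters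
  through the term \<open>k * y t * \<phi> t 0\<close>, and the initial condition through the \<open>\<rho>0\<close> term.
\<close>

definition weak_solution ::
  "(real \<Rightarrow> real) \<Rightarrow> real \<Rightarrow> (real \<Rightarrow> real) \<Rightarrow> (real \<Rightarrow> real \<Rightarrow> real) \<Rightarrow> bool"
where
  "weak_solution lam k \<rho>0 \<rho> \<longleftrightarrow>
     continuous_L2 \<rho> \<and>
     (\<exists>y. L2_loc_halfline y \<and>
       (\<forall>\<tau>>0. \<forall>\<phi> \<phi>t \<phi>x.
          C1_on_rectangle \<tau> \<phi> \<phi>t \<phi>x \<longrightarrow> (\<forall>x\<in>{0..1}. \<phi> \<tau> x = 0) \<longrightarrow>
          - (LINT t:{0..\<tau>}|lebesgue. LINT x:{0<..<1}|lebesgue.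
               \<rho> t x * (\<phi>t t x + lam (total_mass \<rho> t) * \<phi>x t x))
          - (LINT x:{0<..<1}|lebesgue. \<rho>0 x * \<phi> 0 x)
          + (LINT t:{0..\<tau>}|lebesgue. y t * \<phi> t 1 - k * y t * \<phi> t 0) = 0))"

end

theory Submission
  imports Defs
begin

text \<open>
  Along the flow a particle moves with the common velocity
  \<open>\<Lambda> t = lam (total_mass \<rho> t)\<close>, and each time it leaves at \<open>x = 1\<close> and
  re-enters at \<open>x = 0\<close> its density is multiplied by \<open>k\<close>. If
  \<open>\<xi> t = integral {0..t} \<Lambda>\<close> is the distance travelled, the solution is therefore
  \<open>\<rho> t x = k ^ j * \<rho>0 (x - \<xi> t + j)\<close> with the integer \<open>j\<close> that puts
  the argument into the unit interval. Since \<open>j > \<xi> t - 1\<close>, the \<open>L\<^sup>2\<close> norm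
  at time \<open>t\<close> is, for \<open>k \<noteq> 0\<close>, at most
  \<open>\<bar>k\<bar> powr (\<xi> t - 1)\<close> times its initial value. The nonlinearity enters only
  through the speed at which \<open>\<xi>\<close> grows. The formula shows that the \<open>L\<^sup>1\<close>
  norm never exceeds its initial value, so the mass stays in \<open>[-R, R]\<close>, where \<open>lam\<close>
  has a positive minimum \<open>m\<close>; thus \<open>\<xi> t \<ge> m * t\<close> and the decay is
  exponential at a rate that depends only on \<open>k\<close>, \<open>R\<close> and \<open>lam\<close>.

  A weak solution has to be shown to obey the formula. With the solution given, \<open>\<Lambda>\<close> is a known
  continuous function of time and the equation becomes linear, so duality applies
  (\<open>weak_solution_pairing\<close>): a \<open>C\<^sup>1\<close> profile prescribed at time \<open>\<tau>\<close> is carried back along the flow by a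
  function that satisfies the adjoint boundary law, and testing with it eliminates the outflux and
  evaluates the pairing of \<open>\<rho> \<tau>\<close> with the profile in terms of \<open>\<rho>0\<close>. Translating the integrals
  (\<open>wave_pairing_eq_transported_pairing\<close>) and letting the profiles approach indicators of intervals
  (\<open>AE_eq_0_if_bump_pairings_0\<close>) gives the formula almost everywhere (\<open>weak_solution_representation\<close>),
  and \<open>transported_power_bound\<close> gives the norms.
\<close>

section \<open>Square integrable functions on the unit interval\<close>

lemma set_integrable_const_unit_interval [simp]: "set_integrable lebesgue {0<..<1::real} (\<lambda>_. c::real)"
  by (simp add: set_integrable_def)

lemma set_integral_const_unit_interval [simp]: "(LINT x:{0<..<1::real}|lebesgue. (c::real)) = c"
  by (simp add: set_lebesgue_integral_def)

lemma in_L2_imp_set_integrable: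
  assumes "in_L2 {0<..<1} f"
  shows "set_integrable lebesgue {0<..<1} f"
proof (rule set_integrable_bound)
  show "set_integrable lebesgue {0<..<1} (\<lambda>x. 1 + (f x)\<^sup>2)"
    using assms by (auto simp: in_L2_def intro!: set_integral_add)
  show "set_borel_measurable lebesgue {0<..<1} f"
    using assms by (simp add: in_L2_def)
  have "\<bar>a\<bar> \<le> 1 + a\<^sup>2" for a :: real
  proof -
    have "0 \<le> (\<bar>a\<bar> - 1)\<^sup>2" by simp
    then have "2 * \<bar>a\<bar> \<le> 1 + a\<^sup>2" by (simp add: power2_diff)
    then show ?thesis using abs_ge_zero[of a] by linarith
  qed
  then show "AE x in lebesgue. x \<in> {0<..<1} \<longrightarrow> norm (f x) \<le> norm (1 + (f x)\<^sup>2)"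
    by (auto intro!: AE_I2 order_trans[OF _ abs_ge_self])
qed

text \<open>
  The interval has length one, so Jensen's inequality applies: the variance of \<open>\<bar>f\<bar>\<close>, with
  \<open>m\<close> its mean, is nonnegative.
\<close>

lemma L1_norm_le_L2_norm:
  assumes "in_L2 {0<..<1} f"
  shows "L1_norm_on {0<..<1} f \<le> L2_norm_on {0<..<1} f"
proof -
  define m where "m = L1_norm_on {0<..<1} f"
  have abs: "set_integrable lebesgue {0<..<1} (\<lambda>x. \<bar>f x\<bar>)"
    using in_L2_imp_set_integrable[OF assms] by (rule set_integrable_abs)
  have sq: "set_integrable lebesgue {0<..<1} (\<lambda>x. (f x)\<^sup>2)"
    using assms by (simp add: in_L2_def)
  have "0 \<le> (LINT x:{0<..<1}|lebesgue. (\<bar>f x\<bar> - m)\<^sup>2)"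
    by (simp add: set_lebesgue_integral_def)
  also have "\<dots> = (LINT x:{0<..<1}|lebesgue. ((f x)\<^sup>2 - (2 * m) * \<bar>f x\<bar>) + m\<^sup>2)"
    by (simp add: power2_diff algebra_simps)
  also have "\<dots> = (LINT x:{0<..<1}|lebesgue. (f x)\<^sup>2) - (2 * m) * m + m\<^sup>2"
    using abs sq by (subst set_integral_add set_integral_diff,
      auto simp: m_def L1_norm_on_def intro!: set_integral_diff)+
  finally have "m\<^sup>2 \<le> (LINT x:{0<..<1}|lebesgue. (f x)\<^sup>2)"
    by (simp add: power2_eq_square)
  then show ?thesis
    by (simp add: L2_norm_on_def m_def real_le_rsqrt)
qed

lemma in_L2_diff:
  assumes "in_L2 S f" "in_L2 S g"
  shows "in_L2 S (\<lambda>x. f x - g x)"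
  unfolding in_L2_def
proof
  show m: "set_borel_measurable lebesgue S (\<lambda>x. f x - g x)"
    using assms borel_measurable_diff
    by (auto simp: in_L2_def set_borel_measurable_def right_diff_distrib)
  have m2: "set_borel_measurable lebesgue S (\<lambda>x. (f x - g x)\<^sup>2)"
  proof -
    have "(\<lambda>x. (indicat_real S x *\<^sub>R (f x - g x))\<^sup>2) \<in> borel_measurable lebesgue"
      using m by (auto simp: set_borel_measurable_def)
    then show ?thesis
      unfolding set_borel_measurable_def
      by (rule measurable_cong[THEN iffD1, rotated]) (auto simp: indicator_def)
  qed
  show "set_integrable lebesgue S (\<lambda>x. (f x - g x)\<^sup>2)"
  proof (rule set_integrable_bound[OF _ m2])
    show "set_integrable lebesgue S (\<lambda>x. 2 * (f x)\<^sup>2 + 2 * (g x)\<^sup>2)"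
      using assms by (auto simp: in_L2_def intro!: set_integral_add)
    have "(a - b)\<^sup>2 \<le> 2 * a\<^sup>2 + 2 * b\<^sup>2" for a b :: real
    proof -
      have "0 \<le> (a + b)\<^sup>2" by simp
      then show ?thesis by (simp add: power2_eq_square algebra_simps)
    qed
    then show "AE x in lebesgue. x \<in> S \<longrightarrow> norm ((f x - g x)\<^sup>2) \<le> norm (2 * (f x)\<^sup>2 + 2 * (g x)\<^sup>2)"
      by (auto intro!: AE_I2 order_trans[OF _ abs_ge_self])
  qed
qed

lemma set_borel_measurable_continuous_on_unit_interval:
  fixes H :: "real \<Rightarrow> real"
  assumes "continuous_on {0..1} H"
  shows "set_borel_measurable lebesgue {0<..<1} H"
proof -
  have "(\<lambda>x. indicator {0<..<1} x *\<^sub>R H x) \<in> borel_measurable borel"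
    by (rule borel_measurable_continuous_on_indicator)
       (auto intro: continuous_on_subset[OF assms])
  then show ?thesis
    unfolding set_borel_measurable_def by (simp add: measurable_completion)
qed

lemma set_integrable_mult_bounded:
  fixes f H :: "real \<Rightarrow> real"
  assumes f: "set_integrable lebesgue S f" and H: "set_borel_measurable lebesgue S H"
    and B: "\<And>x. x \<in> S \<Longrightarrow> \<bar>H x\<bar> \<le> B"
  shows "set_integrable lebesgue S (\<lambda>x. f x * H x)"
proof (rule set_integrable_bound)
  show "set_integrable lebesgue S (\<lambda>x. B * f x)" using f by simp
  have "(\<lambda>x. (indicat_real S x *\<^sub>R f x) * (indicat_real S x *\<^sub>R H x)) \<in> borel_measurable lebesgue"
    using f H unfolding set_integrable_def set_borel_measurable_def
    by (intro borel_measurable_times) auto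
  then show "set_borel_measurable lebesgue S (\<lambda>x. f x * H x)"
    unfolding set_borel_measurable_def
    by (rule measurable_cong[THEN iffD1, rotated]) (auto simp: indicator_def)
  show "AE x in lebesgue. x \<in> S \<longrightarrow> norm (f x * H x) \<le> norm (B * f x)"
  proof (intro AE_I2 impI)
    fix x assume "x \<in> S"
    then have "\<bar>H x\<bar> * \<bar>f x\<bar> \<le> \<bar>B\<bar> * \<bar>f x\<bar>"
      using B[of x] by (intro mult_right_mono) auto
    then show "norm (f x * H x) \<le> norm (B * f x)" by (simp add: abs_mult mult.commute)
  qed
qed

lemma set_integrable_mult_continuous:
  fixes f H :: "real \<Rightarrow> real"
  assumes f: "set_integrable lebesgue {0<..<1} f" and H: "continuous_on {0..1} H"
  shows "set_integrable lebesgue {0<..<1} (\<lambda>x. f x * H x)"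
proof -
  have "bounded (H ` {0..1})"
    using H by (intro compact_imp_bounded compact_continuous_image) auto
  then obtain B where "\<forall>x\<in>{0..1}. \<bar>H x\<bar> \<le> B" by (auto simp: bounded_real)
  then show ?thesis
    by (intro set_integrable_mult_bounded[OF f, where B = B]
          set_borel_measurable_continuous_on_unit_interval H) auto
qed

lemma abs_set_integral_mult_le:
  fixes f H :: "real \<Rightarrow> real"
  assumes f: "set_integrable lebesgue {0<..<1} f" and H: "continuous_on {0..1} H"
    and B: "\<And>x. x \<in> {0<..<1} \<Longrightarrow> \<bar>H x\<bar> \<le> B"
  shows "\<bar>LINT x:{0<..<1}|lebesgue. f x * H x\<bar> \<le> B * L1_norm_on {0<..<1} f"
proof -
  have i: "set_integrable lebesgue {0<..<1} (\<lambda>x. f x * H x)"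
    by (rule set_integrable_mult_continuous[OF f H])
  have "\<bar>LINT x:{0<..<1}|lebesgue. f x * H x\<bar> \<le> (LINT x:{0<..<1}|lebesgue. \<bar>f x * H x\<bar>)"
    using set_integral_norm_bound[OF i] by simp
  also have "\<dots> \<le> (LINT x:{0<..<1}|lebesgue. B * \<bar>f x\<bar>)"
  proof (rule set_integral_mono)
    show "set_integrable lebesgue {0<..<1} (\<lambda>x. \<bar>f x * H x\<bar>)" using i by (rule set_integrable_abs)
    show "set_integrable lebesgue {0<..<1} (\<lambda>x. B * \<bar>f x\<bar>)" using set_integrable_abs[OF f] by simp
    show "\<bar>f x * H x\<bar> \<le> B * \<bar>f x\<bar>" if "x \<in> {0<..<1}" for x
      using mult_left_mono[OF B[OF that], of "\<bar>f x\<bar>"] by (simp add: abs_mult mult.commute)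
  qed
  also have "\<dots> = B * L1_norm_on {0<..<1} f" by (simp add: L1_norm_on_def)
  finally show ?thesis .
qed

text \<open>
  Both factors move with time. The difference of two values splits into the change of \<open>\<rho>\<close> against
  a bounded \<open>H\<close>, which is small because \<open>L\<^sup>2\<close> distance dominates \<open>L\<^sup>1\<close> distance, and the change
  of \<open>H\<close> against the integrable \<open>\<rho> t\<close>, which is small because \<open>H\<close> is uniformly continuous on the
  compact rectangle. Mass, velocity and pairings with test functions all owe their continuity in
  time to this.
\<close>

lemma continuous_on_pairing:
  assumes \<rho>: "continuous_L2 \<rho>"
    and H: "continuous_on ({0..T} \<times> {0..1}) (\<lambda>(t, x). H t x)"
  shows "continuous_on {0..T} (\<lambda>t. LINT x:{0<..<1}|lebesgue. \<rho> t x * H t x)"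
  unfolding continuous_on_def
proof
  fix t assume t: "t \<in> {0..T}"
  define K where "K = {0..T} \<times> {0..1::real}"
  have K: "compact K" unfolding K_def by (intro compact_Times) auto
  have L2: "in_L2 {0<..<1} (\<rho> s)" if "s \<in> {0..T}" for s
    using \<rho> that by (auto simp: continuous_L2_def)
  note L1 = in_L2_imp_set_integrable[OF L2]
  have Hx: "continuous_on {0..1} (H s)" if "s \<in> {0..T}" for s
  proof -
    have "continuous_on {0..1} ((\<lambda>(t, x). H t x) \<circ> Pair s)"
      by (rule continuous_on_compose) (use that in \<open>auto intro!: continuous_intros continuous_on_subset[OF H]\<close>)
    then show ?thesis by (simp add: o_def)
  qed
  have "bounded ((\<lambda>(t, x). H t x) ` K)"
    using H K by (intro compact_imp_bounded compact_continuous_image) (auto simp: K_def)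
  then obtain B0 where "\<forall>z\<in>K. \<bar>(case z of (t, x) \<Rightarrow> H t x)\<bar> \<le> B0" by (auto simp: bounded_real)
  then obtain B where B: "\<And>s x. s \<in> {0..T} \<Longrightarrow> x \<in> {0..1} \<Longrightarrow> \<bar>H s x\<bar> \<le> B"
    by (force simp: K_def)
  have unif: "uniformly_continuous_on K (\<lambda>(t, x). H t x)"
    using H K by (intro compact_uniformly_continuous) (auto simp: K_def)
  let ?P = "\<lambda>s. LINT x:{0<..<1}|lebesgue. \<rho> s x * H s x"
  let ?D = "\<lambda>s. L2_norm_on {0<..<1} (\<lambda>x. \<rho> s x - \<rho> t x)"
  have step: "\<bar>?P s - ?P t\<bar> \<le> B * ?D s + e * L1_norm_on {0<..<1} (\<rho> t)"
    if s: "s \<in> {0..T}" and e: "\<And>x. x \<in> {0<..<1} \<Longrightarrow> \<bar>H s x - H t x\<bar> \<le> e" for s e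
  proof -
    have d2: "in_L2 {0<..<1} (\<lambda>x. \<rho> s x - \<rho> t x)"
      by (intro in_L2_diff L2 s t)
    note d1 = in_L2_imp_set_integrable[OF d2]
    have i1: "set_integrable lebesgue {0<..<1} (\<lambda>x. (\<rho> s x - \<rho> t x) * H s x)"
      by (intro set_integrable_mult_continuous d1 Hx s)
    have i2: "set_integrable lebesgue {0<..<1} (\<lambda>x. \<rho> t x * (H s x - H t x))"
      by (intro set_integrable_mult_continuous L1 t continuous_intros Hx s)
    have "?P s - ?P t = (LINT x:{0<..<1}|lebesgue. \<rho> s x * H s x - \<rho> t x * H t x)"
      by (intro set_integral_diff(2)[symmetric] set_integrable_mult_continuous L1 Hx s t)
    also have "\<dots> = (LINT x:{0<..<1}|lebesgue. (\<rho> s x - \<rho> t x) * H s x + \<rho> t x * (H s x - H t x))"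
      by (simp add: algebra_simps)
    also have "\<dots> = (LINT x:{0<..<1}|lebesgue. (\<rho> s x - \<rho> t x) * H s x)
                   + (LINT x:{0<..<1}|lebesgue. \<rho> t x * (H s x - H t x))"
      by (intro set_integral_add(2) i1 i2)
    finally have "\<bar>?P s - ?P t\<bar> \<le> \<bar>LINT x:{0<..<1}|lebesgue. (\<rho> s x - \<rho> t x) * H s x\<bar>
        + \<bar>LINT x:{0<..<1}|lebesgue. \<rho> t x * (H s x - H t x)\<bar>" by simp
    also have "\<bar>LINT x:{0<..<1}|lebesgue. (\<rho> s x - \<rho> t x) * H s x\<bar>
        \<le> B * L1_norm_on {0<..<1} (\<lambda>x. \<rho> s x - \<rho> t x)"
      using B s by (intro abs_set_integral_mult_le d1 Hx) auto
    also have "\<dots> \<le> B * ?D s"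
      using B[OF t, of 0] by (intro mult_left_mono L1_norm_le_L2_norm d2) auto
    also have "\<bar>LINT x:{0<..<1}|lebesgue. \<rho> t x * (H s x - H t x)\<bar>
        \<le> e * L1_norm_on {0<..<1} (\<rho> t)"
      using e s t by (intro abs_set_integral_mult_le L1 continuous_intros Hx) auto
    finally show ?thesis by simp
  qed
  have L1nn: "0 \<le> L1_norm_on {0<..<1} (\<rho> t)"
    by (simp add: L1_norm_on_def set_lebesgue_integral_def)
  show "(?P \<longlongrightarrow> ?P t) (at t within {0..T})"
  proof (rule tendstoI)
    fix e :: real assume "e > 0"
    define e1 where "e1 = e / (2 * (L1_norm_on {0<..<1} (\<rho> t) + 1))"
    have e1: "e1 > 0" using \<open>e > 0\<close> L1nn by (simp add: e1_def)
    have e1': "e1 * L1_norm_on {0<..<1} (\<rho> t) < e / 2"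
      using \<open>e > 0\<close> L1nn by (simp add: e1_def field_simps)
    from unif e1 obtain d where d: "d > 0"
      "\<And>z z'. z \<in> K \<Longrightarrow> z' \<in> K \<Longrightarrow> dist z' z < d \<Longrightarrow>
        dist (case z' of (t, x) \<Rightarrow> H t x) (case z of (t, x) \<Rightarrow> H t x) < e1"
      unfolding uniformly_continuous_on_def by metis
    have near: "\<forall>\<^sub>F s in at t within {0..T}. dist s t < d"
      using d(1) by (simp add: eventually_at_filter eventually_nhds_metric) blast
    have "((\<lambda>s. ?D s) \<longlongrightarrow> 0) (at t within {0..T})"
      using \<rho> t by (auto simp: continuous_L2_def intro: tendsto_within_subset)
    then have "((\<lambda>s. B * ?D s) \<longlongrightarrow> B * 0) (at t within {0..T})"
      by (intro tendsto_intros)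
    then have "\<forall>\<^sub>F s in at t within {0..T}. B * ?D s < e / 2"
      by (rule order_tendstoD(2)) (use \<open>e > 0\<close> in simp)
    moreover have "\<forall>\<^sub>F s in at t within {0..T}. s \<in> {0..T}"
      by (simp add: eventually_at_filter)
    ultimately show "\<forall>\<^sub>F s in at t within {0..T}. dist (?P s) (?P t) < e"
      using near
    proof eventually_elim
      case (elim s)
      have "\<bar>H s x - H t x\<bar> \<le> e1" if "x \<in> {0<..<1}" for x
        using d(2)[of "(t, x)" "(s, x)"] elim t that
        by (auto simp: K_def dist_Pair_Pair dist_real_def)
      from step[OF elim(2) this] elim(1) e1' show ?case by (simp add: dist_real_def)
    qed
  qed
qed

section \<open>Smooth bumps determine an integrable function\<close>

text \<open>
  A \<open>C\<^sup>1\<close> substitute for the indicator of \<open>{a<..<b}\<close>: with \<open>p\<close> the square of the positive part of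
  \<open>(x - a) * (b - x)\<close>, the quotient \<open>p / (p + \<epsilon>)\<close> vanishes off the interval and tends to \<open>1\<close> on it
  as \<open>\<epsilon>\<close> tends to \<open>0\<close>. Squaring is what makes it differentiable at \<open>a\<close> and \<open>b\<close>.
\<close>

definition bump :: "real \<Rightarrow> real \<Rightarrow> real \<Rightarrow> real \<Rightarrow> real" where
  "bump a b \<epsilon> x = (max 0 ((x - a) * (b - x)))\<^sup>2 / ((max 0 ((x - a) * (b - x)))\<^sup>2 + \<epsilon>)"

lemma has_real_derivative_positive_part_squared:
  "((\<lambda>u. (max 0 u)\<^sup>2) has_real_derivative 2 * max 0 u) (at (u::real))"
proof -
  consider "u > 0" | "u < 0" | "u = 0" by linarith
  then show ?thesis
  proof cases
    case 1
    have "((\<lambda>u. u\<^sup>2) has_real_derivative 2 * max 0 u) (at u)"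
      using 1 by (auto intro!: derivative_eq_intros)
    then show ?thesis
      by (rule has_field_derivative_transform_within_open[where S = "{0<..}"]) (use 1 in auto)
  next
    case 2
    have "((\<lambda>u. 0) has_real_derivative 2 * max 0 u) (at u)"
      using 2 by (auto intro!: derivative_eq_intros)
    then show ?thesis
      by (rule has_field_derivative_transform_within_open[where S = "{..<0}"]) (use 2 in auto)
  next
    case 3
    have "((\<lambda>h. ((max 0 h)\<^sup>2 / h)) \<longlongrightarrow> (0::real)) (at 0)"
    proof (rule Lim_null_comparison)
      show "\<forall>\<^sub>F h in at 0. norm ((max 0 h)\<^sup>2 / h) \<le> \<bar>h::real\<bar>"
        by (intro always_eventually allI) (auto simp: max_def power2_eq_square)
      show "((\<lambda>h. \<bar>h::real\<bar>) \<longlongrightarrow> 0) (at 0)"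
        by (intro tendsto_rabs_zero tendsto_ident_at)
    qed
    then show ?thesis using 3 by (simp add: DERIV_def)
  qed
qed

lemma bump_has_continuous_derivative:
  assumes "\<epsilon> > 0"
  shows "\<exists>\<Psi>'. continuous_on UNIV \<Psi>' \<and> (\<forall>x. (bump a b \<epsilon> has_real_derivative \<Psi>' x) (at x))"
proof -
  define p where "p = (\<lambda>x. (max 0 ((x - a) * (b - x)))\<^sup>2)"
  define p' where "p' = (\<lambda>x. 2 * max 0 ((x - a) * (b - x)) * (a + b - 2 * x))"
  have p: "(p has_real_derivative p' x) (at x)" for x
    unfolding p_def p'_def
    by (rule DERIV_chain'[OF _ has_real_derivative_positive_part_squared])
       (auto intro!: derivative_eq_intros simp: algebra_simps)
  have pos: "p x + \<epsilon> > 0" for x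
    using assms by (simp add: p_def add_nonneg_pos)
  have ne: "p x + \<epsilon> \<noteq> 0" for x using pos[of x] by simp
  have "continuous_on UNIV p" "continuous_on UNIV p'"
    unfolding p_def p'_def by (intro continuous_intros)+
  then have "continuous_on UNIV (\<lambda>x. (p' x * (p x + \<epsilon>) - p x * p' x) / ((p x + \<epsilon>) * (p x + \<epsilon>)))"
    using ne by (intro continuous_intros) auto
  moreover have "bump a b \<epsilon> = (\<lambda>x. p x / (p x + \<epsilon>))"
    by (simp add: bump_def p_def fun_eq_iff)
  moreover have "((\<lambda>x. p x / (p x + \<epsilon>)) has_real_derivative
      (p' x * (p x + \<epsilon>) - p x * p' x) / ((p x + \<epsilon>) * (p x + \<epsilon>))) (at x)" for x
    using ne[of x] p[of x] by (auto intro!: derivative_eq_intros)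
  ultimately show ?thesis by auto
qed

lemma bump_eq_0: "a \<le> b \<Longrightarrow> x \<notin> {a<..<b} \<Longrightarrow> bump a b \<epsilon> x = 0"
  by (auto simp: bump_def max_def zero_le_mult_iff mult_le_0_iff)

lemma bump_bounds:
  assumes "\<epsilon> > 0" shows "0 \<le> bump a b \<epsilon> x" "bump a b \<epsilon> x \<le> 1"
  using assms by (auto simp: bump_def divide_le_eq_1 add_nonneg_pos intro!: divide_nonneg_pos)

lemma bump_tendsto_indicator:
  assumes "a \<le> b"
  shows "(\<lambda>n. bump a b (1 / real (Suc n)) x) \<longlonglongrightarrow> indicator {a<..<b} x"
proof (cases "x \<in> {a<..<b}")
  case True
  define p where "p = (max 0 ((x - a) * (b - x)))\<^sup>2"
  have "p > 0" using True by (simp add: p_def)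
  have "(\<lambda>n. p / (p + 1 / real (Suc n))) \<longlonglongrightarrow> p / (p + 0)"
    by (intro tendsto_intros lim_1_over_n[THEN LIMSEQ_Suc]) (use \<open>p > 0\<close> in auto)
  then show ?thesis using True \<open>p > 0\<close> by (simp add: bump_def p_def)
qed (simp add: bump_eq_0[OF assms])

text \<open>
  The sets over which the integral vanishes are closed under complements and countable disjoint
  unions, and contain the closed intervals, so they include all Borel sets. Passing to a Borel
  version \<open>g\<close> of \<open>f\<close> is what makes this class large enough for \<open>density_zero\<close>.
\<close>

lemma AE_eq_0_if_interval_integrals_0:
  fixes f :: "real \<Rightarrow> real"
  assumes f: "integrable lebesgue f"
    and zero: "\<And>a b. a < b \<Longrightarrow> (LINT x:{a<..<b}|lebesgue. f x) = 0"
  shows "AE x in lebesgue. f x = 0"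
proof -
  obtain g where g: "g \<in> borel_measurable lborel" "AE x in lborel. f x = g x"
    using completion_ex_borel_measurable_real[of f lborel] f by auto
  have fg: "AE x in lebesgue. f x = g x" using g(2) by (rule AE_completion)
  have gi: "integrable lborel g"
  proof -
    have "integrable lebesgue g"
      by (rule Bochner_Integration.integrable_cong_AE_imp[OF f])
         (use g fg in \<open>auto intro: measurable_completion\<close>)
    then show ?thesis using g(1) by (simp add: integrable_completion)
  qed
  have eq: "(LINT x:A|lborel. g x) = (LINT x:A|lebesgue. f x)" if "A \<in> sets borel" for A
  proof -
    have "(LINT x:A|lborel. g x) = (LINT x:A|lebesgue. g x)"
      unfolding set_lebesgue_integral_def
      using that g(1) by (intro integral_completion[symmetric]) auto
    also have "\<dots> = (LINT x:A|lebesgue. f x)"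
      unfolding set_lebesgue_integral_def
    proof (rule integral_cong_AE)
      show "(\<lambda>x. indicat_real A x *\<^sub>R g x) \<in> borel_measurable lebesgue"
        using that g(1) by (intro measurable_completion) auto
      show "(\<lambda>x. indicat_real A x *\<^sub>R f x) \<in> borel_measurable lebesgue"
        using that by (intro borel_measurable_integrable integrable_mult_indicator f) auto
    qed (use fg in auto)
    finally show ?thesis .
  qed
  have si: "set_integrable lborel A g" if "A \<in> sets borel" for A
    unfolding set_integrable_def using that gi by (intro integrable_mult_indicator) auto
  have open_iv: "(LINT x:{a<..<b}|lborel. g x) = 0" if "a < b" for a b
    using zero[OF that] by (simp add: eq)
  \<comment> \<open>The complement step below needs the integral over the whole line.\<close>
  have total: "(LINT x|lborel. g x) = 0"
  proof -
    have "(\<lambda>n. LINT x:{- real (Suc n)<..<real (Suc n)}|lborel. g x)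
        \<longlonglongrightarrow> (LINT x:(\<Union>n. {- real (Suc n)<..<real (Suc n)})|lborel. g x)"
      by (intro set_integral_cont_up si) (auto intro!: monoI)
    moreover have "(\<Union>n. {- real (Suc n)<..<real (Suc n)}) = UNIV"
    proof -
      have "\<exists>n. - real (Suc n) < x \<and> x < real (Suc n)" for x
        using reals_Archimedean2[of "\<bar>x\<bar>"] by (metis abs_less_iff less_SucI lessI less_trans minus_less_iff of_nat_less_iff)
      then show ?thesis by auto
    qed
    ultimately have "(\<lambda>n. 0) \<longlonglongrightarrow> (LINT x:UNIV|lborel. g x)"
      by (simp add: open_iv)
    then show ?thesis
      by (simp add: LIMSEQ_const_iff set_lebesgue_integral_def)
  qed
  have "(LINT x:A|lborel. g x) = 0" if "A \<in> sets borel" for A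
    using that
  proof (induction rule: borel_set_induct)
    case empty
    then show ?case by (simp add: set_lebesgue_integral_def)
  next
    case (interval a b)
    have "(LINT x:{a..b}|lborel. g x) = (LINT x:{a<..<b}|lborel. g x)"
      unfolding set_lebesgue_integral_def
    proof (rule integral_cong_AE)
      have "AE x in lborel. x \<noteq> a \<and> x \<noteq> b"
        using AE_lborel_singleton[of a] AE_lborel_singleton[of b] by eventually_elim auto
      then show "AE x in lborel. indicat_real {a..b} x *\<^sub>R g x = indicat_real {a<..<b} x *\<^sub>R g x"
        by eventually_elim (auto simp: indicator_def)
    qed (use g in auto)
    also have "\<dots> = 0"
      using open_iv[of a b] by (cases "a < b") (auto simp: set_lebesgue_integral_def)
    finally show ?case .
  next
    case (compl A)
    have "(LINT x:A \<union> -A|lborel. g x) = (LINT x:A|lborel. g x) + (LINT x:-A|lborel. g x)"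
      using compl by (intro set_integral_Un si) auto
    then show ?case
      using compl total by (simp add: set_lebesgue_integral_def)
  next
    case (union F)
    have "(LINT x:(\<Union>i. F i)|lborel. g x) = (\<Sum>i. LINT x:F i|lborel. g x)"
      using union by (intro lebesgue_integral_countable_add si) (auto simp: disjoint_family_on_def)
    then show ?case using union by simp
  qed
  then have "AE x in lborel. g x = 0"
    by (intro sigma_finite_measure.density_zero[OF sigma_finite_lborel] gi) auto
  then have "AE x in lborel. f x = 0" using g(2) by eventually_elim simp
  then show ?thesis by (rule AE_completion)
qed

text \<open>
  The fundamental lemma of the calculus of variations: letting \<open>\<epsilon>\<close> tend to \<open>0\<close>, dominated
  convergence turns the pairings with bumps into integrals over intervals.
\<close>

lemma AE_eq_0_if_bump_pairings_0:
  assumes d: "set_integrable lebesgue {0<..<1} d"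
    and zero: "\<And>a b \<epsilon>. 0 \<le> a \<Longrightarrow> a < b \<Longrightarrow> b \<le> 1 \<Longrightarrow> \<epsilon> > 0 \<Longrightarrow>
      (LINT x:{0<..<1}|lebesgue. d x * bump a b \<epsilon> x) = 0"
  shows "AE x in lebesgue. x \<in> {0<..<1} \<longrightarrow> d x = 0"
proof -
  define D where "D = (\<lambda>x. indicat_real {0<..<1} x * d x)"
  have D: "integrable lebesgue D" using d by (simp add: D_def set_integrable_def)
  have main: "(LINT x:{a<..<b}|lebesgue. D x) = 0" if ab: "0 \<le> a" "a < b" "b \<le> 1" for a b
  proof -
    let ?s = "\<lambda>n x. D x * bump a b (1 / real (Suc n)) x"
    have meas: "?s n \<in> borel_measurable lebesgue" for n
    proof -
      obtain \<Psi>' where "\<forall>x. (bump a b (1 / real (Suc n)) has_real_derivative \<Psi>' x) (at x)"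
        using bump_has_continuous_derivative[of "1 / real (Suc n)" a b] by auto
      then have "continuous_on UNIV (bump a b (1 / real (Suc n)))"
        by (meson DERIV_isCont continuous_at_imp_continuous_on)
      then have "bump a b (1 / real (Suc n)) \<in> borel_measurable lebesgue"
        by (intro measurable_completion) (simp add: borel_measurable_continuous_onI)
      then show ?thesis using D by (intro borel_measurable_times) auto
    qed
    have "(\<lambda>n. LINT x|lebesgue. ?s n x) \<longlonglongrightarrow> (LINT x|lebesgue. D x * indicat_real {a<..<b} x)"
    proof (rule integral_dominated_convergence[where w = "\<lambda>x. \<bar>D x\<bar>"])
      show "(\<lambda>x. D x * indicat_real {a<..<b} x) \<in> borel_measurable lebesgue"
        using D by (intro borel_measurable_times borel_measurable_indicator) auto
      show "integrable lebesgue (\<lambda>x. \<bar>D x\<bar>)" using D by simp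
      show "AE x in lebesgue. (\<lambda>n. ?s n x) \<longlonglongrightarrow> D x * indicat_real {a<..<b} x"
        using ab by (intro AE_I2 tendsto_intros bump_tendsto_indicator) auto
      show "AE x in lebesgue. norm (?s n x) \<le> \<bar>D x\<bar>" for n
        using bump_bounds[of "1 / real (Suc n)" a b]
        by (intro AE_I2) (auto simp: abs_mult intro!: mult_left_le)
    qed (rule meas)
    moreover have "(LINT x|lebesgue. ?s n x) = 0" for n
      using zero[OF ab, of "1 / real (Suc n)"]
      by (simp add: set_lebesgue_integral_def D_def mult.assoc)
    ultimately have "(LINT x|lebesgue. D x * indicat_real {a<..<b} x) = 0"
      by (simp add: LIMSEQ_const_iff)
    then show ?thesis by (simp add: set_lebesgue_integral_def mult.commute)
  qed
  have "AE x in lebesgue. D x = 0"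
  proof (rule AE_eq_0_if_interval_integrals_0[OF D])
    fix a b :: real assume "a < b"
    have eq: "(LINT x:{a<..<b}|lebesgue. D x) = (LINT x:{max a 0<..<min b 1}|lebesgue. D x)"
      unfolding set_lebesgue_integral_def
      by (intro Bochner_Integration.integral_cong) (auto simp: D_def indicator_def)
    show "(LINT x:{a<..<b}|lebesgue. D x) = 0"
    proof (cases "max a 0 < min b 1")
      case True
      show ?thesis unfolding eq by (rule main) (use True in auto)
    next
      case False
      then have empty: "{max a 0<..<min b 1} = {}" by (intro greaterThanLessThan_empty) linarith
      show ?thesis unfolding eq empty by (simp add: set_lebesgue_integral_def)
    qed
  qed
  then show ?thesis by eventually_elim (auto simp: D_def)
qed

section \<open>Profiles adapted to the boundary law\<close>

text \<open>
  For a profile \<open>\<Psi>\<close> supported in the unit interval this is the function on \<open>[0, N + 1]\<close> that equals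
  \<open>\<Psi>\<close> on the first unit cell and is multiplied by \<open>k\<close> from each cell to the next. Adding
  translates, instead of gluing the cells, makes its smoothness evident, also for \<open>k = 0\<close>.
\<close>

definition wave :: "nat \<Rightarrow> real \<Rightarrow> (real \<Rightarrow> real) \<Rightarrow> real \<Rightarrow> real" where
  "wave N k \<Psi> s = (\<Sum>j\<le>N. k ^ j * \<Psi> (s - real j))"

text \<open>
  This relation makes the boundary terms of the weak formulation cancel. It fails in general
  outside the stated range of \<open>s\<close>: below \<open>0\<close> the cell to the left is missing, above \<open>N\<close> the cell to
  the right.
\<close>

lemma wave_shift:
  assumes \<Psi>: "\<And>x. x \<notin> {0<..<1} \<Longrightarrow> \<Psi> x = 0" and s: "0 \<le> s" "s \<le> real N"
  shows "wave N k \<Psi> (1 + s) = k * wave N k \<Psi> s"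
proof -
  have "wave N k \<Psi> (1 + s) = (\<Sum>j<N. k ^ Suc j * \<Psi> (s - real j))"
    unfolding wave_def using s by (simp add: sum.atMost_shift \<Psi>)
  also have "\<dots> = k * wave N k \<Psi> s"
    unfolding wave_def lessThan_Suc_atMost[symmetric]
    using s by (simp add: \<Psi> sum_distrib_left mult.assoc)
  finally show ?thesis .
qed

lemma wave_eq_profile:
  assumes \<Psi>: "\<And>x. x \<notin> {0<..<1} \<Longrightarrow> \<Psi> x = 0" and "x \<le> 1"
  shows "wave N k \<Psi> x = \<Psi> x"
proof -
  have "wave N k \<Psi> x = (\<Sum>j\<le>N. if j = 0 then \<Psi> x else 0)"
    unfolding wave_def by (intro sum.cong) (use \<open>x \<le> 1\<close> in \<open>auto simp: \<Psi>\<close>)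
  then show ?thesis by simp
qed

lemma continuous_on_wave:
  assumes "continuous_on UNIV \<Psi>"
  shows "continuous_on UNIV (wave N k \<Psi>)"
  unfolding wave_def
  by (intro continuous_intros continuous_on_compose2[OF assms]) auto

lemma wave_has_real_derivative:
  assumes "\<And>x. (\<Psi> has_real_derivative \<Psi>' x) (at x)"
  shows "(wave N k \<Psi> has_real_derivative wave N k \<Psi>' s) (at s)"
proof -
  have "((\<lambda>s. k ^ j * \<Psi> (s - real j)) has_real_derivative k ^ j * \<Psi>' (s - real j)) (at s)" for j
  proof (rule DERIV_cmult)
    have "((\<lambda>s. \<Psi> (s - real j)) has_real_derivative \<Psi>' (s - real j) * 1) (at s)"
      by (rule DERIV_chain2[OF assms]) (auto intro!: derivative_eq_intros)
    then show "((\<lambda>s. \<Psi> (s - real j)) has_real_derivative \<Psi>' (s - real j)) (at s)" by simp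
  qed
  then show ?thesis unfolding wave_def by (intro DERIV_sum) auto
qed

section \<open>Pairing a weak solution with a profile\<close>

definition velocity :: "(real \<Rightarrow> real) \<Rightarrow> (real \<Rightarrow> real \<Rightarrow> real) \<Rightarrow> real \<Rightarrow> real" where
  "velocity lam \<rho> t = lam (total_mass \<rho> t)"

definition displacement :: "(real \<Rightarrow> real) \<Rightarrow> (real \<Rightarrow> real \<Rightarrow> real) \<Rightarrow> real \<Rightarrow> real" where
  "displacement lam \<rho> t = integral {0..t} (velocity lam \<rho>)"

lemma continuous_on_velocity:
  assumes lam: "continuous_on UNIV lam" and \<rho>: "continuous_L2 \<rho>"
  shows "continuous_on {0..T} (velocity lam \<rho>)"
proof -
  have "continuous_on {0..T} (total_mass \<rho>)"
    using continuous_on_pairing[OF \<rho>, of T "\<lambda>_ _. 1"]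
    by (simp add: total_mass_def[abs_def])
  then show ?thesis
    unfolding velocity_def by (intro continuous_on_compose2[OF lam]) auto
qed

lemma displacement_has_real_derivative:
  assumes "continuous_on UNIV lam" "continuous_L2 \<rho>" "t \<in> {0..T}"
  shows "(displacement lam \<rho> has_real_derivative velocity lam \<rho> t) (at t within {0..T})"
  unfolding displacement_def
  by (intro integral_has_real_derivative continuous_on_velocity assms)

lemma continuous_on_displacement:
  assumes "continuous_on UNIV lam" "continuous_L2 \<rho>"
  shows "continuous_on {0..T} (displacement lam \<rho>)"
  using displacement_has_real_derivative[OF assms]
  by (intro DERIV_continuous_on)

lemma displacement_mono:
  assumes lam: "continuous_on UNIV lam" and \<rho>: "continuous_L2 \<rho>"
    and pos: "\<And>s. lam s > 0" and st: "0 \<le> s" "s \<le> t"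
  shows "displacement lam \<rho> s \<le> displacement lam \<rho> t"
  unfolding displacement_def
proof (rule integral_subset_le)
  show "velocity lam \<rho> integrable_on {0..s}" "velocity lam \<rho> integrable_on {0..t}"
    by (intro integrable_continuous_interval continuous_on_velocity lam \<rho>)+
qed (use st pos in \<open>auto simp: velocity_def less_imp_le\<close>)

text \<open>
  The transport equation preserves pairings with functions carried along the flow. A profile
  \<open>\<Psi>\<close> prescribed at time \<open>\<tau>\<close> is carried back to time \<open>t\<close> as \<open>h (x + \<xi> \<tau> - \<xi> t)\<close>, where \<open>h\<close> is its
  wave and \<open>\<xi>\<close> the displacement; at \<open>x = 1\<close> this function is \<open>k\<close> times its value at \<open>x = 0\<close>, so
  the unknown outflux drops out. Multiplied by a function \<open>\<eta> t\<close> that vanishes at \<open>\<tau>\<close>, it is an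
  admissible test function, and its derivative along the flow is \<open>\<eta>'\<close> times \<open>h\<close>. With \<open>G t\<close> the
  pairing at time \<open>t\<close> and \<open>G0\<close> that of the initial datum, the weak formulation says that \<open>\<eta>'\<close> is
  orthogonal to \<open>G - G0\<close>.
\<close>

lemma weak_solution_pairing:
  assumes sol: "weak_solution lam k \<rho>0 \<rho>" and lam: "continuous_on UNIV lam"
    and pos: "\<And>s. lam s > 0"
    and \<Psi>': "\<And>x. (\<Psi> has_real_derivative \<Psi>' x) (at x)" "continuous_on UNIV \<Psi>'"
    and \<Psi>0: "\<And>x. x \<notin> {0<..<1} \<Longrightarrow> \<Psi> x = 0"
    and \<tau>: "\<tau> > 0" and N: "displacement lam \<rho> \<tau> \<le> real N"
  shows "(LINT x:{0<..<1}|lebesgue. \<rho> \<tau> x * \<Psi> x)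
       = (LINT x:{0<..<1}|lebesgue. \<rho>0 x * wave N k \<Psi> (x + displacement lam \<rho> \<tau>))"
proof -
  have \<rho>: "continuous_L2 \<rho>" using sol by (simp add: weak_solution_def)
  have wave_profile: "wave N k \<Psi> x = \<Psi> x" if "x \<in> {0<..<1}" for x
    using wave_eq_profile[of \<Psi> x N k] \<Psi>0 that by force
  define \<Lambda> where "\<Lambda> = velocity lam \<rho>"
  define \<xi> where "\<xi> = displacement lam \<rho>"
  define h where "h = wave N k \<Psi>"
  define h' where "h' = wave N k \<Psi>'"
  have \<xi>': "(\<xi> has_real_derivative \<Lambda> t) (at t within {0..\<tau>})" if "t \<in> {0..\<tau>}" for t
    unfolding \<xi>_def \<Lambda>_def by (rule displacement_has_real_derivative[OF lam \<rho> that])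
  have \<xi>c: "continuous_on {0..\<tau>} \<xi>"
    unfolding \<xi>_def by (rule continuous_on_displacement[OF lam \<rho>])
  have \<Lambda>c: "continuous_on {0..\<tau>} \<Lambda>"
    unfolding \<Lambda>_def by (rule continuous_on_velocity[OF lam \<rho>])
  have \<xi>0: "\<xi> 0 = 0" by (simp add: \<xi>_def displacement_def)
  have \<xi>range: "0 \<le> \<xi> \<tau> - \<xi> t" "\<xi> \<tau> - \<xi> t \<le> real N" if "t \<in> {0..\<tau>}" for t
    using displacement_mono[OF lam \<rho> pos, of t \<tau>] displacement_mono[OF lam \<rho> pos, of 0 t] N \<xi>0 that
    by (auto simp: \<xi>_def)
  have \<Psi>c: "continuous_on UNIV \<Psi>"
    using \<Psi>'(1) by (meson DERIV_isCont continuous_at_imp_continuous_on)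
  have hc: "continuous_on UNIV h" "continuous_on UNIV h'"
    unfolding h_def h'_def by (intro continuous_on_wave \<Psi>c \<Psi>')+
  have hd: "(h has_real_derivative h' s) (at s)" for s
    unfolding h_def h'_def by (intro wave_has_real_derivative \<Psi>')
  define G where "G = (\<lambda>t. LINT x:{0<..<1}|lebesgue. \<rho> t x * h (x + \<xi> \<tau> - \<xi> t))"
  define G0 where "G0 = (LINT x:{0<..<1}|lebesgue. \<rho>0 x * h (x + \<xi> \<tau>))"
  have arg: "continuous_on ({0..\<tau>} \<times> {0..1}) (\<lambda>p. snd p + \<xi> \<tau> - \<xi> (fst p))"
    by (intro continuous_intros continuous_on_compose2[OF \<xi>c]) auto
  have Gc: "continuous_on {0..\<tau>} G"
    unfolding G_def
    by (intro continuous_on_pairing \<rho>)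
       (auto simp: case_prod_unfold intro!: continuous_on_compose2[OF hc(1) arg])
  \<comment> \<open>Taking \<open>G - G0\<close> itself as the derivative of \<open>\<eta>\<close> forces it to vanish.\<close>
  define e where "e = (\<lambda>t. G t - G0)"
  define \<eta> where "\<eta> = (\<lambda>t. integral {0..t} e - integral {0..\<tau>} e)"
  have ec: "continuous_on {0..\<tau>} e" unfolding e_def by (intro continuous_intros Gc)
  have \<eta>': "(\<eta> has_real_derivative e t) (at t within {0..\<tau>})" if "t \<in> {0..\<tau>}" for t
    unfolding \<eta>_def using integral_has_real_derivative[OF ec that]
    by (auto intro!: derivative_eq_intros)
  have \<eta>c: "continuous_on {0..\<tau>} \<eta>" using \<eta>' by (intro DERIV_continuous_on)
  define \<phi> where "\<phi> = (\<lambda>t x. \<eta> t * h (x + \<xi> \<tau> - \<xi> t))"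
  define \<phi>x where "\<phi>x = (\<lambda>t x. \<eta> t * h' (x + \<xi> \<tau> - \<xi> t))"
  define \<phi>t where "\<phi>t = (\<lambda>t x. e t * h (x + \<xi> \<tau> - \<xi> t) - \<Lambda> t * \<phi>x t x)"
  have C1: "C1_on_rectangle \<tau> \<phi> \<phi>t \<phi>x"
    unfolding C1_on_rectangle_def
  proof (intro conjI ballI)
    show "continuous_on ({0..\<tau>} \<times> {0..1}) (\<lambda>(t, x). \<phi> t x)"
      "continuous_on ({0..\<tau>} \<times> {0..1}) (\<lambda>(t, x). \<phi>t t x)"
      "continuous_on ({0..\<tau>} \<times> {0..1}) (\<lambda>(t, x). \<phi>x t x)"
      unfolding \<phi>_def \<phi>t_def \<phi>x_def case_prod_unfold
      by (intro continuous_intros continuous_on_compose2[OF \<eta>c] continuous_on_compose2[OF ec]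
            continuous_on_compose2[OF \<Lambda>c] continuous_on_compose2[OF hc(1) arg]
            continuous_on_compose2[OF hc(2) arg]; auto)+
    fix t x assume t: "t \<in> {0..\<tau>}" and x: "x \<in> {0..1::real}"
    have "((\<lambda>s. h (x + \<xi> \<tau> - \<xi> s)) has_real_derivative h' (x + \<xi> \<tau> - \<xi> t) * (- \<Lambda> t)) (at t within {0..\<tau>})"
      by (rule DERIV_chain2[OF hd]) (auto intro!: derivative_eq_intros \<xi>' t)
    then show "((\<lambda>s. \<phi> s x) has_real_derivative \<phi>t t x) (at t within {0..\<tau>})"
      unfolding \<phi>_def \<phi>t_def \<phi>x_def
      by (rule DERIV_cong[OF DERIV_mult[OF \<eta>'[OF t]]]) (simp add: algebra_simps)
    have "((\<lambda>z. h (z + \<xi> \<tau> - \<xi> t)) has_real_derivative h' (x + \<xi> \<tau> - \<xi> t) * 1) (at x within {0..1})"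
      by (rule DERIV_chain2[OF hd]) (auto intro!: derivative_eq_intros)
    then show "((\<lambda>z. \<phi> t z) has_real_derivative \<phi>x t x) (at x within {0..1})"
      unfolding \<phi>_def \<phi>x_def by (auto intro!: derivative_eq_intros)
  qed
  have final: "\<forall>x\<in>{0..1}. \<phi> \<tau> x = 0" by (simp add: \<phi>_def \<eta>_def)
  from sol C1 final \<tau> obtain y where
    "- (LINT t:{0..\<tau>}|lebesgue. LINT x:{0<..<1}|lebesgue.
           \<rho> t x * (\<phi>t t x + lam (total_mass \<rho> t) * \<phi>x t x))
      - (LINT x:{0<..<1}|lebesgue. \<rho>0 x * \<phi> 0 x)
      + (LINT t:{0..\<tau>}|lebesgue. y t * \<phi> t 1 - k * y t * \<phi> t 0) = 0"
    unfolding weak_solution_def by blast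
  \<comment> \<open>The velocity terms of \<open>\<phi>t\<close> and \<open>\<phi>x\<close> cancel.\<close>
  moreover have "(LINT x:{0<..<1}|lebesgue. \<rho> t x * (\<phi>t t x + lam (total_mass \<rho> t) * \<phi>x t x)) = e t * G t" for t
  proof -
    have "\<rho> t x * (\<phi>t t x + lam (total_mass \<rho> t) * \<phi>x t x) = e t * (\<rho> t x * h (x + \<xi> \<tau> - \<xi> t))" for x
      by (simp add: \<phi>t_def \<Lambda>_def velocity_def)
    then show ?thesis by (simp only: G_def set_integral_mult_right)
  qed
  moreover have "(LINT x:{0<..<1}|lebesgue. \<rho>0 x * \<phi> 0 x) = \<eta> 0 * G0"
  proof -
    have "\<rho>0 x * \<phi> 0 x = \<eta> 0 * (\<rho>0 x * h (x + \<xi> \<tau>))" for x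
      by (simp add: \<phi>_def \<xi>0)
    then show ?thesis by (simp only: G0_def set_integral_mult_right)
  qed
  \<comment> \<open>The boundary law of the wave cancels the flux terms.\<close>
  moreover have "(LINT t:{0..\<tau>}|lebesgue. y t * \<phi> t 1 - k * y t * \<phi> t 0) = (LINT t:{0..\<tau>}|lebesgue. 0)"
  proof (rule set_lebesgue_integral_cong)
    show "\<forall>t. t \<in> {0..\<tau>} \<longrightarrow> y t * \<phi> t 1 - k * y t * \<phi> t 0 = 0"
    proof (intro allI impI)
      fix t assume t: "t \<in> {0..\<tau>}"
      have "h (1 + (\<xi> \<tau> - \<xi> t)) = k * h (\<xi> \<tau> - \<xi> t)"
        unfolding h_def by (intro wave_shift \<Psi>0 \<xi>range t)
      then show "y t * \<phi> t 1 - k * y t * \<phi> t 0 = 0"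
        by (simp add: \<phi>_def algebra_simps)
    qed
  qed simp
  ultimately have "(LINT t:{0..\<tau>}|lebesgue. e t * G t) = - \<eta> 0 * G0"
    by simp
  also have "(LINT t:{0..\<tau>}|lebesgue. e t * G t) = integral {0..\<tau>} (\<lambda>t. e t * G t)"
    by (intro set_lebesgue_integral_eq_integral(2) absolutely_integrable_continuous_real
          continuous_intros ec Gc)
  also have "- \<eta> 0 * G0 = integral {0..\<tau>} (\<lambda>t. e t * G0)"
    by (simp add: \<eta>_def)
  finally have "integral {0..\<tau>} (\<lambda>t. e t * G t) - integral {0..\<tau>} (\<lambda>t. e t * G0) = 0" by simp
  also have "integral {0..\<tau>} (\<lambda>t. e t * G t) - integral {0..\<tau>} (\<lambda>t. e t * G0)
      = integral {0..\<tau>} (\<lambda>t. e t * G t - e t * G0)"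
    by (intro integral_diff[symmetric] integrable_continuous_interval continuous_intros ec Gc)
  also have "\<dots> = integral {0..\<tau>} (\<lambda>t. (e t)\<^sup>2)"
    by (simp add: e_def power2_eq_square algebra_simps)
  finally have "\<forall>t\<in>{0..\<tau>}. (e t)\<^sup>2 = 0"
    using \<tau> by (subst (asm) integral_eq_0_iff) (auto intro!: continuous_intros ec)
  then have "G \<tau> = G0" using \<tau> by (auto simp: e_def)
  moreover have "G \<tau> = (LINT x:{0<..<1}|lebesgue. \<rho> \<tau> x * \<Psi> x)"
    unfolding G_def
    by (intro set_lebesgue_integral_cong) (auto simp: h_def wave_profile)
  ultimately show ?thesis by (simp add: G0_def h_def \<xi>_def)
qed

text \<open>
  The weak formulation prescribes the initial datum only through an integral, and only
  for \<open>\<tau> > 0\<close>. That \<open>\<rho> 0\<close> agrees with \<open>\<rho>0\<close> follows by letting \<open>\<tau>\<close> tend to \<open>0\<close> in the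
  preceding identity, both sides of which are continuous.
\<close>

lemma weak_solution_pairing_at_0:
  assumes sol: "weak_solution lam k \<rho>0 \<rho>" and lam: "continuous_on UNIV lam"
    and pos: "\<And>s. lam s > 0" and \<rho>0: "in_L2 {0<..<1} \<rho>0"
    and \<Psi>': "\<And>x. (\<Psi> has_real_derivative \<Psi>' x) (at x)" "continuous_on UNIV \<Psi>'"
    and \<Psi>0: "\<And>x. x \<notin> {0<..<1} \<Longrightarrow> \<Psi> x = 0"
  shows "(LINT x:{0<..<1}|lebesgue. \<rho> 0 x * \<Psi> x) = (LINT x:{0<..<1}|lebesgue. \<rho>0 x * \<Psi> x)"
proof -
  have \<rho>: "continuous_L2 \<rho>" using sol by (simp add: weak_solution_def)
  have const: "continuous_L2 (\<lambda>_. \<rho>0)"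
    using \<rho>0 by (simp add: continuous_L2_def L2_norm_on_def)
  have \<Psi>c: "continuous_on UNIV \<Psi>"
    using \<Psi>'(1) by (meson DERIV_isCont continuous_at_imp_continuous_on)
  let ?\<xi> = "displacement lam \<rho>"
  \<comment> \<open>One \<open>N\<close> serves all times in \<open>{0<..1}\<close>, because the displacement is monotone.\<close>
  obtain N :: nat where N: "?\<xi> 1 \<le> real N" using real_arch_simple by blast
  have wave_profile: "wave N k \<Psi> x = \<Psi> x" if "x \<in> {0<..<1}" for x
    using wave_eq_profile[of \<Psi> x N k] \<Psi>0 that by force
  define D where "D = (\<lambda>t. (LINT x:{0<..<1}|lebesgue. \<rho> t x * \<Psi> x)
      - (LINT x:{0<..<1}|lebesgue. \<rho>0 x * wave N k \<Psi> (x + ?\<xi> t)))"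
  have "continuous_on {0..1} D"
    unfolding D_def
  proof (rule continuous_on_diff)
    show "continuous_on {0..1} (\<lambda>t. LINT x:{0<..<1}|lebesgue. \<rho> t x * \<Psi> x)"
      by (intro continuous_on_pairing \<rho>)
         (auto simp: case_prod_unfold intro!: continuous_on_compose2[OF \<Psi>c] continuous_intros)
    have "continuous_on ({0..1} \<times> {0..1}) (\<lambda>p. snd p + ?\<xi> (fst p))"
      by (intro continuous_intros continuous_on_compose2[OF continuous_on_displacement[OF lam \<rho>]]) auto
    then show "continuous_on {0..1} (\<lambda>t. LINT x:{0<..<1}|lebesgue. \<rho>0 x * wave N k \<Psi> (x + ?\<xi> t))"
      by (intro continuous_on_pairing[OF const])
         (auto simp: case_prod_unfold intro!: continuous_on_compose2[OF continuous_on_wave[OF \<Psi>c]])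
  qed
  then have "continuous_on (closure {0<..1}) D" by simp
  then have "D 0 = 0"
  proof (rule continuous_constant_on_closure)
    fix t :: real assume t: "t \<in> {0<..1}"
    then have "?\<xi> t \<le> real N" using displacement_mono[OF lam \<rho> pos, of t 1] N by auto
    then show "D t = 0"
      using weak_solution_pairing[OF sol lam pos \<Psi>' \<Psi>0, of t N] t by (auto simp: D_def)
  qed auto
  moreover have "(LINT x:{0<..<1}|lebesgue. \<rho>0 x * wave N k \<Psi> (x + ?\<xi> 0)) = (LINT x:{0<..<1}|lebesgue. \<rho>0 x * \<Psi> x)"
    by (intro set_lebesgue_integral_cong) (auto simp: displacement_def wave_profile)
  ultimately show ?thesis by (simp add: D_def)
qed

section \<open>The solution formula and its estimates\<close>

text \<open>
  The initial datum after a displacement \<open>\<xi>\<close>: a particle at \<open>z\<close> that has crossed the boundary \<open>j\<close>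
  times started at \<open>z - \<xi> + j\<close> and has been damped by \<open>k ^ j\<close>. The indicator extends \<open>f\<close> by zero, so
  for almost every \<open>z\<close> in the unit interval exactly one \<open>j\<close> contributes, provided that
  \<open>0 \<le> \<xi> \<le> N\<close>.
\<close>

definition transported :: "nat \<Rightarrow> real \<Rightarrow> real \<Rightarrow> (real \<Rightarrow> real) \<Rightarrow> real \<Rightarrow> real" where
  "transported N k \<xi> f z =
     (\<Sum>j\<le>N. k ^ j * (indicator {0<..<1} (z - \<xi> + real j) * f (z - \<xi> + real j)))"

lemma integrable_translate:
  fixes F :: "real \<Rightarrow> real"
  shows "integrable lebesgue F \<Longrightarrow> integrable lebesgue (\<lambda>z. F (z - \<xi> + c))"
  using lebesgue_integrable_real_affine[of F 1 "c - \<xi>"] by (simp add: algebra_simps)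

lemma integral_translate:
  fixes F :: "real \<Rightarrow> real"
  shows "(LINT z|lebesgue. F (z - \<xi> + c)) = (LINT w|lebesgue. F w)"
  using lebesgue_integral_real_affine[of 1 F "c - \<xi>"] by (simp add: algebra_simps)

lemma integrable_transported:
  assumes "set_integrable lebesgue {0<..<1} f"
  shows "integrable lebesgue (transported N k \<xi> f)"
proof -
  have "integrable lebesgue (\<lambda>w. indicator {0<..<1} w * f w)"
    using assms by (simp add: set_integrable_def)
  from integrable_translate[OF this] show ?thesis
    unfolding transported_def by (intro Bochner_Integration.integrable_sum integrable_mult_right) auto
qed

text \<open>
  Moving \<open>f\<close> forward is adjoint to moving the profile backward; each term of the two sums is the
  same integral after a translation.
\<close>

lemma wave_pairing_eq_transported_pairing:
  assumes f: "set_integrable lebesgue {0<..<1} f"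
    and \<Psi>c: "continuous_on UNIV \<Psi>" and \<Psi>0: "\<And>x. x \<notin> {0<..<1} \<Longrightarrow> \<Psi> x = 0"
  shows "(LINT x:{0<..<1}|lebesgue. f x * wave N k \<Psi> (x + \<xi>))
       = (LINT z:{0<..<1}|lebesgue. transported N k \<xi> f z * \<Psi> z)"
proof -
  define F where "F = (\<lambda>w. indicat_real {0<..<1} w * f w)"
  have i: "integrable lebesgue (\<lambda>w. F w * \<Psi> (w + \<xi> - real j))" for j
  proof -
    have "set_integrable lebesgue {0<..<1} (\<lambda>w. f w * \<Psi> (w + \<xi> - real j))"
      by (intro set_integrable_mult_continuous f continuous_on_compose2[OF \<Psi>c] continuous_intros) auto
    then show ?thesis by (simp add: set_integrable_def F_def mult.assoc)
  qed
  have i': "integrable lebesgue (\<lambda>z. F (z - \<xi> + real j) * \<Psi> z)" for j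
    using integrable_translate[OF i[of j], of \<xi> "real j"] by simp
  have "(LINT x:{0<..<1}|lebesgue. f x * wave N k \<Psi> (x + \<xi>))
      = (LINT w|lebesgue. (\<Sum>j\<le>N. k ^ j * (F w * \<Psi> (w + \<xi> - real j))))"
    unfolding set_lebesgue_integral_def F_def wave_def
    by (intro Bochner_Integration.integral_cong) (auto simp: sum_distrib_left algebra_simps)
  also have "\<dots> = (\<Sum>j\<le>N. k ^ j * (LINT w|lebesgue. F w * \<Psi> (w + \<xi> - real j)))"
    using i by (subst Bochner_Integration.integral_sum) auto
  also have "\<dots> = (\<Sum>j\<le>N. k ^ j * (LINT z|lebesgue. F (z - \<xi> + real j) * \<Psi> z))"
  proof (intro sum.cong refl arg_cong2[where f = "(*)"])
    fix j show "(LINT w|lebesgue. F w * \<Psi> (w + \<xi> - real j)) = (LINT z|lebesgue. F (z - \<xi> + real j) * \<Psi> z)"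
      using integral_translate[of "\<lambda>w. F w * \<Psi> (w + \<xi> - real j)" \<xi> "real j"] by simp
  qed
  also have "\<dots> = (LINT z|lebesgue. (\<Sum>j\<le>N. k ^ j * (F (z - \<xi> + real j) * \<Psi> z)))"
    using i' by (subst Bochner_Integration.integral_sum) auto
  also have "\<dots> = (LINT z:{0<..<1}|lebesgue. transported N k \<xi> f z * \<Psi> z)"
    unfolding set_lebesgue_integral_def F_def transported_def
    by (intro Bochner_Integration.integral_cong)
       (auto simp: sum_distrib_left sum_distrib_right algebra_simps \<Psi>0 indicator_def)
  finally show ?thesis .
qed

lemma abs_sum_power_at_most_one_nonzero:
  fixes x :: "'a \<Rightarrow> real"
  assumes A: "finite A" "\<And>i j. i \<in> A \<Longrightarrow> j \<in> A \<Longrightarrow> x i \<noteq> 0 \<Longrightarrow> x j \<noteq> 0 \<Longrightarrow> i = j"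
    and p: "p > 0"
  shows "\<bar>sum x A\<bar> ^ p = (\<Sum>i\<in>A. \<bar>x i\<bar> ^ p)"
proof (cases "\<forall>i\<in>A. x i = 0")
  case True
  then show ?thesis using p by simp
next
  case False
  then obtain j where j: "j \<in> A" "x j \<noteq> 0" by blast
  then have "\<And>i. i \<in> A - {j} \<Longrightarrow> x i = 0" using A by blast
  then show ?thesis using p A(1) j by (simp add: sum.remove)
qed

text \<open>
  The translates of the open unit interval by integers are disjoint.
\<close>

lemma sum_indicator_shifts_le_1:
  "(\<Sum>j\<le>N. indicat_real {0<..<1} (w - real j)) \<le> 1"
proof (cases "\<forall>j\<le>N. w - real j \<notin> {0<..<1}")
  case False
  then obtain j where j: "j \<le> N" "w - real j \<in> {0<..<1}" by blast
  have "w - real i \<notin> {0<..<1}" if "i \<noteq> j" for i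
    using j that by (cases i j rule: linorder_cases) auto
  then have "(\<Sum>i\<in>{..N} - {j}. indicat_real {0<..<1} (w - real i)) = 0"
    by (intro sum.neutral) (auto simp: indicator_def)
  then show ?thesis using j by (simp add: sum.remove[of "{..N}" j])
qed simp

text \<open>
  The translated copies of \<open>f\<close> that make up the transported function do not overlap within the
  unit interval, so the power of the sum is the sum of the powers. A copy with index \<open>j\<close> reaches
  the unit interval only if \<open>j > \<xi> - 1\<close>, and hence carries a factor of at most \<open>q\<close>. After each copy
  is translated back, the copies integrate \<open>\<bar>f\<bar> ^ p\<close> over disjoint pieces of the unit interval. The
  mass estimate uses \<open>p = 1\<close>, the decay estimate \<open>p = 2\<close>.
\<close>

lemma transported_power_bound:
  assumes f: "set_integrable lebesgue {0<..<1} f"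
    and fp: "set_integrable lebesgue {0<..<1} (\<lambda>x. \<bar>f x\<bar> ^ p)" and p: "p > 0"
    and q: "q \<ge> 0" "\<And>j. real j > \<xi> - 1 \<Longrightarrow> \<bar>k\<bar> ^ j \<le> q"
  shows "(LINT z:{0<..<1}|lebesgue. \<bar>transported N k \<xi> f z\<bar> ^ p)
       \<le> q ^ p * (LINT x:{0<..<1}|lebesgue. \<bar>f x\<bar> ^ p)"
proof -
  define u where "u = (\<lambda>w. indicat_real {0<..<1} w * \<bar>f w\<bar> ^ p)"
  have u: "integrable lebesgue u" using fp by (simp add: u_def set_integrable_def)
  have u0: "u w \<ge> 0" for w by (simp add: u_def)
  \<comment> \<open>The part of \<open>u\<close> that copy \<open>j\<close> brings into the unit interval, at its original position.\<close>
  define v where "v = (\<lambda>j w. indicat_real {0<..<1} (w + \<xi> - real j) * u w)"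
  have v: "integrable lebesgue (v j)" for j
  proof -
    have "integrable lebesgue (\<lambda>w. indicator {real j - \<xi><..<real j - \<xi> + 1} w *\<^sub>R u w)"
      by (intro integrable_mult_indicator u) auto
    then show ?thesis
      by (rule Bochner_Integration.integrable_cong[THEN iffD1, rotated 2]) (auto simp: v_def indicator_def)
  qed
  have pointwise: "indicat_real {0<..<1} z * \<bar>transported N k \<xi> f z\<bar> ^ p
      \<le> q ^ p * (\<Sum>j\<le>N. v j (z - \<xi> + real j))" for z
  proof (cases "z \<in> {0<..<1}")
    case True
    have "\<bar>transported N k \<xi> f z\<bar> ^ p
        = (\<Sum>j\<le>N. \<bar>k ^ j * (indicator {0<..<1} (z - \<xi> + real j) * f (z - \<xi> + real j))\<bar> ^ p)"
      unfolding transported_def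
    proof (rule abs_sum_power_at_most_one_nonzero)
      fix i j
      assume "k ^ i * (indicator {0<..<1} (z - \<xi> + real i) * f (z - \<xi> + real i)) \<noteq> 0"
        "k ^ j * (indicator {0<..<1} (z - \<xi> + real j) * f (z - \<xi> + real j)) \<noteq> 0"
      then have "z - \<xi> + real i \<in> {0<..<1}" "z - \<xi> + real j \<in> {0<..<1}"
        by (auto simp: indicator_def split: if_splits)
      then show "i = j" by (cases i j rule: linorder_cases) auto
    qed (use p in auto)
    also have "\<dots> \<le> (\<Sum>j\<le>N. q ^ p * v j (z - \<xi> + real j))"
    proof (rule sum_mono)
      fix j
      show "\<bar>k ^ j * (indicator {0<..<1} (z - \<xi> + real j) * f (z - \<xi> + real j))\<bar> ^ p
          \<le> q ^ p * v j (z - \<xi> + real j)"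
      proof (cases "z - \<xi> + real j \<in> {0<..<1}")
        case inside: True
        have "(\<bar>k\<bar> ^ j) ^ p \<le> q ^ p"
          using True inside by (intro power_mono q(2)) auto
        then show ?thesis
          using True inside
          by (simp add: v_def u_def abs_mult power_mult_distrib power_abs mult_right_mono)
      qed (use p in \<open>auto simp: v_def u_def zero_power\<close>)
    qed
    finally show ?thesis using True by (simp add: sum_distrib_left)
  qed (use q in \<open>simp add: v_def\<close>)
  have "(LINT z:{0<..<1}|lebesgue. \<bar>transported N k \<xi> f z\<bar> ^ p)
      \<le> (LINT z|lebesgue. q ^ p * (\<Sum>j\<le>N. v j (z - \<xi> + real j)))"
    unfolding set_lebesgue_integral_def real_scaleR_def
  proof (rule integral_mono_AE')
    show "integrable lebesgue (\<lambda>z. q ^ p * (\<Sum>j\<le>N. v j (z - \<xi> + real j)))"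
      by (intro integrable_mult_right Bochner_Integration.integrable_sum integrable_translate v)
    show "AE z in lebesgue. 0 \<le> q ^ p * (\<Sum>j\<le>N. v j (z - \<xi> + real j))"
      using q(1) by (intro AE_I2 mult_nonneg_nonneg sum_nonneg) (auto simp: v_def u0)
  qed (use pointwise in auto)
  also have "\<dots> = q ^ p * (\<Sum>j\<le>N. LINT z|lebesgue. v j (z - \<xi> + real j))"
    using integrable_translate[OF v] by (simp add: Bochner_Integration.integral_sum)
  also have "\<dots> = q ^ p * (\<Sum>j\<le>N. LINT w|lebesgue. v j w)"
    by (simp add: integral_translate)
  also have "\<dots> = q ^ p * (LINT w|lebesgue. (\<Sum>j\<le>N. v j w))"
    using v by (simp add: Bochner_Integration.integral_sum)
  also have "\<dots> \<le> q ^ p * (LINT w|lebesgue. u w)"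
  proof (intro mult_left_mono integral_mono)
    fix w
    have "(\<Sum>j\<le>N. v j w) = (\<Sum>j\<le>N. indicat_real {0<..<1} (w + \<xi> - real j)) * u w"
      by (simp add: v_def sum_distrib_right)
    also have "\<dots> \<le> 1 * u w"
      by (intro mult_right_mono sum_indicator_shifts_le_1 u0)
    finally show "(\<Sum>j\<le>N. v j w) \<le> u w" by simp
  qed (use u v q in auto)
  also have "\<dots> = q ^ p * (LINT x:{0<..<1}|lebesgue. \<bar>f x\<bar> ^ p)"
    by (simp add: u_def set_lebesgue_integral_def)
  finally show ?thesis .
qed

text \<open>
  Both sides have the same pairing with every bump, the left one by duality and the right one by
  moving the translations from the profile to the initial datum.
\<close>

lemma weak_solution_representation:
  assumes sol: "weak_solution lam k \<rho>0 \<rho>" and lam: "continuous_on UNIV lam"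
    and pos: "\<And>s. lam s > 0" and \<rho>0: "in_L2 {0<..<1} \<rho>0"
    and t: "t \<ge> 0" and N: "displacement lam \<rho> t \<le> real N"
  shows "AE x in lebesgue. x \<in> {0<..<1} \<longrightarrow> \<rho> t x = transported N k (displacement lam \<rho> t) \<rho>0 x"
proof -
  let ?g = "transported N k (displacement lam \<rho> t) \<rho>0"
  have \<rho>0i: "set_integrable lebesgue {0<..<1} \<rho>0" by (rule in_L2_imp_set_integrable[OF \<rho>0])
  have \<rho>i: "set_integrable lebesgue {0<..<1} (\<rho> t)"
    using sol t by (intro in_L2_imp_set_integrable) (simp add: weak_solution_def continuous_L2_def)
  have gi: "set_integrable lebesgue {0<..<1} ?g"
    unfolding set_integrable_def by (intro integrable_mult_indicator integrable_transported \<rho>0i) auto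
  have "AE x in lebesgue. x \<in> {0<..<1} \<longrightarrow> \<rho> t x - ?g x = 0"
  proof (rule AE_eq_0_if_bump_pairings_0)
    show "set_integrable lebesgue {0<..<1} (\<lambda>x. \<rho> t x - ?g x)" by (intro set_integral_diff \<rho>i gi)
    fix a b \<epsilon> :: real assume ab: "0 \<le> a" "a < b" "b \<le> 1" "\<epsilon> > 0"
    define \<Psi> where "\<Psi> = bump a b \<epsilon>"
    obtain \<Psi>' where \<Psi>': "\<And>x. (\<Psi> has_real_derivative \<Psi>' x) (at x)" "continuous_on UNIV \<Psi>'"
      using bump_has_continuous_derivative[OF ab(4)] unfolding \<Psi>_def by metis
    have \<Psi>0: "\<Psi> x = 0" if "x \<notin> {0<..<1}" for x
      unfolding \<Psi>_def using ab that by (intro bump_eq_0) auto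
    have \<Psi>c: "continuous_on UNIV \<Psi>"
      using \<Psi>'(1) by (meson DERIV_isCont continuous_at_imp_continuous_on)
    have wave_profile: "wave N k \<Psi> x = \<Psi> x" if "x \<in> {0<..<1}" for x
      using wave_eq_profile[of \<Psi> x N k] \<Psi>0 that by force
    have "(LINT x:{0<..<1}|lebesgue. \<rho> t x * \<Psi> x)
        = (LINT x:{0<..<1}|lebesgue. \<rho>0 x * wave N k \<Psi> (x + displacement lam \<rho> t))"
    proof (cases "t = 0")
      case True
      have "(LINT x:{0<..<1}|lebesgue. \<rho>0 x * wave N k \<Psi> (x + displacement lam \<rho> 0))
          = (LINT x:{0<..<1}|lebesgue. \<rho>0 x * \<Psi> x)"
        by (intro set_lebesgue_integral_cong) (auto simp: displacement_def wave_profile)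
      then show ?thesis
        using weak_solution_pairing_at_0[OF sol lam pos \<rho>0 \<Psi>' \<Psi>0] True by simp
    next
      case False
      then show ?thesis using weak_solution_pairing[OF sol lam pos \<Psi>' \<Psi>0 _ N] t by auto
    qed
    also have "\<dots> = (LINT x:{0<..<1}|lebesgue. ?g x * \<Psi> x)"
      by (rule wave_pairing_eq_transported_pairing[OF \<rho>0i \<Psi>c \<Psi>0])
    finally have "0 = (LINT x:{0<..<1}|lebesgue. \<rho> t x * \<Psi> x) - (LINT x:{0<..<1}|lebesgue. ?g x * \<Psi> x)"
      by simp
    also have "\<dots> = (LINT x:{0<..<1}|lebesgue. \<rho> t x * \<Psi> x - ?g x * \<Psi> x)"
      by (intro set_integral_diff(2)[symmetric] set_integrable_mult_continuous \<rho>i gi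
            continuous_on_subset[OF \<Psi>c]) auto
    finally show "(LINT x:{0<..<1}|lebesgue. (\<rho> t x - ?g x) * bump a b \<epsilon> x) = 0"
      by (simp add: \<Psi>_def left_diff_distrib)
  qed
  then show ?thesis by simp
qed

lemma weak_solution_power_bound:
  assumes sol: "weak_solution lam k \<rho>0 \<rho>" and lam: "continuous_on UNIV lam"
    and pos: "\<And>s. lam s > 0" and \<rho>0: "in_L2 {0<..<1} \<rho>0" and t: "t \<ge> 0"
    and p: "p > 0" and \<rho>0p: "set_integrable lebesgue {0<..<1} (\<lambda>x. \<bar>\<rho>0 x\<bar> ^ p)"
    and q: "q \<ge> 0" "\<And>j. real j > displacement lam \<rho> t - 1 \<Longrightarrow> \<bar>k\<bar> ^ j \<le> q"
  shows "(LINT x:{0<..<1}|lebesgue. \<bar>\<rho> t x\<bar> ^ p) \<le> q ^ p * (LINT x:{0<..<1}|lebesgue. \<bar>\<rho>0 x\<bar> ^ p)"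
proof -
  obtain N :: nat where N: "displacement lam \<rho> t \<le> real N" using real_arch_simple by blast
  let ?g = "transported N k (displacement lam \<rho> t) \<rho>0"
  have \<rho>0i: "set_integrable lebesgue {0<..<1} \<rho>0" by (rule in_L2_imp_set_integrable[OF \<rho>0])
  have \<rho>m: "set_borel_measurable lebesgue {0<..<1} (\<rho> t)"
    using sol t by (simp add: weak_solution_def continuous_L2_def in_L2_def)
  have eq: "indicat_real {0<..<1} x * \<bar>h x\<bar> ^ p = \<bar>indicat_real {0<..<1} x * h x\<bar> ^ p" for h and x :: real
    using p by (simp add: indicator_def)
  have "(LINT x:{0<..<1}|lebesgue. \<bar>\<rho> t x\<bar> ^ p) = (LINT x:{0<..<1}|lebesgue. \<bar>?g x\<bar> ^ p)"
    unfolding set_lebesgue_integral_def real_scaleR_def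
  proof (rule integral_cong_AE)
    have "(\<lambda>x. indicat_real {0<..<1} x * \<rho> t x) \<in> borel_measurable lebesgue"
      using \<rho>m by (simp add: set_borel_measurable_def)
    then show "(\<lambda>x. indicat_real {0<..<1} x * \<bar>\<rho> t x\<bar> ^ p) \<in> borel_measurable lebesgue"
      unfolding eq by (intro borel_measurable_power borel_measurable_abs)
    have "?g \<in> borel_measurable lebesgue"
      using integrable_transported[OF \<rho>0i] by (rule borel_measurable_integrable)
    then have "(\<lambda>x. indicat_real {0<..<1} x * ?g x) \<in> borel_measurable lebesgue"
      by (intro borel_measurable_times borel_measurable_indicator) auto
    then show "(\<lambda>x. indicat_real {0<..<1} x * \<bar>?g x\<bar> ^ p) \<in> borel_measurable lebesgue"
      unfolding eq by (intro borel_measurable_power borel_measurable_abs)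
    show "AE x in lebesgue. indicat_real {0<..<1} x * \<bar>\<rho> t x\<bar> ^ p = indicat_real {0<..<1} x * \<bar>?g x\<bar> ^ p"
      using weak_solution_representation[OF sol lam pos \<rho>0 t N]
      by eventually_elim (auto simp: indicator_def)
  qed
  also have "\<dots> \<le> q ^ p * (LINT x:{0<..<1}|lebesgue. \<bar>\<rho>0 x\<bar> ^ p)"
    by (rule transported_power_bound[OF \<rho>0i \<rho>0p p q])
  finally show ?thesis .
qed

text \<open>
  For \<open>\<bar>k\<bar> \<le> 1\<close> the boundary law does not amplify, so the velocity is evaluated only at arguments bounded by the
  \<open>L\<^sup>1\<close> norm of the initial datum. This a priori bound makes the constants of the theorem uniform.
\<close>

lemma weak_solution_mass_bound:
  assumes sol: "weak_solution lam k \<rho>0 \<rho>" and lam: "continuous_on UNIV lam"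
    and pos: "\<And>s. lam s > 0" and \<rho>0: "in_L2 {0<..<1} \<rho>0" and t: "t \<ge> 0" and k: "\<bar>k\<bar> \<le> 1"
  shows "\<bar>total_mass \<rho> t\<bar> \<le> L1_norm_on {0<..<1} \<rho>0"
proof -
  have i: "set_integrable lebesgue {0<..<1} (\<rho> t)"
    using sol t by (intro in_L2_imp_set_integrable) (simp add: weak_solution_def continuous_L2_def)
  have "\<bar>total_mass \<rho> t\<bar> \<le> (LINT x:{0<..<1}|lebesgue. \<bar>\<rho> t x\<bar> ^ 1)"
    using set_integral_norm_bound[OF i] by (simp add: total_mass_def)
  also have "\<dots> \<le> 1 ^ 1 * (LINT x:{0<..<1}|lebesgue. \<bar>\<rho>0 x\<bar> ^ 1)"
    using set_integrable_abs[OF in_L2_imp_set_integrable[OF \<rho>0]] k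
    by (intro weak_solution_power_bound[OF sol lam pos \<rho>0 t]) (auto intro: power_le_one)
  finally show ?thesis by (simp add: L1_norm_on_def)
qed

theorem theorem4p1:
  fixes lam :: "real \<Rightarrow> real"
  assumes "lam C1_differentiable_on UNIV"
    and "\<forall>s. lam s > 0"
  shows "\<forall>k\<in>{-1<..<1}. \<forall>R>0. \<exists>C>0. \<exists>\<alpha>>0.
           \<forall>\<rho>0. in_L2 {0<..<1} \<rho>0 \<longrightarrow> L1_norm_on {0<..<1} \<rho>0 \<le> R \<longrightarrow>
             (\<forall>\<rho>. weak_solution lam k \<rho>0 \<rho> \<longrightarrow>
               (\<forall>t\<ge>0. L2_norm_on {0<..<1} (\<rho> t)
                        \<le> C * exp (- \<alpha> * t) * L2_norm_on {0<..<1} \<rho>0))"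
proof (intro ballI allI impI)
  fix k R :: real assume k: "k \<in> {-1<..<1}" and R: "R > 0"
  have lam: "continuous_on UNIV lam"
    using assms(1) by (rule C1_differentiable_imp_continuous_on)
  have pos: "\<And>s. lam s > 0" using assms(2) by blast
  obtain w where w: "\<forall>s\<in>{-R..R}. lam w \<le> lam s"
    using continuous_attains_inf[of "{-R..R}" lam] R continuous_on_subset[OF lam] by auto
  \<comment> \<open>A lower bound for the velocity of every solution whose mass stays in \<open>{-R..R}\<close>.\<close>
  define m where "m = lam w"
  have m: "m > 0" using pos by (simp add: m_def)
  \<comment> \<open>The maximum with \<open>1 / 2\<close> keeps the logarithm meaningful when \<open>k = 0\<close>.\<close>
  define \<kappa> where "\<kappa> = max \<bar>k\<bar> (1 / 2)"
  have \<kappa>: "0 < \<kappa>" "\<kappa> < 1" "\<bar>k\<bar> \<le> \<kappa>" using k by (auto simp: \<kappa>_def)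
  define C where "C = 1 / \<kappa>"
  define \<alpha> where "\<alpha> = - (m * ln \<kappa>)"
  have C: "C > 0" using \<kappa> by (simp add: C_def)
  have \<alpha>: "\<alpha> > 0" using m \<kappa> by (simp add: \<alpha>_def mult_pos_neg)
  have "L2_norm_on {0<..<1} (\<rho> t) \<le> C * exp (- \<alpha> * t) * L2_norm_on {0<..<1} \<rho>0"
    if \<rho>0: "in_L2 {0<..<1} \<rho>0" "L1_norm_on {0<..<1} \<rho>0 \<le> R"
      and sol: "weak_solution lam k \<rho>0 \<rho>" and t: "t \<ge> 0" for \<rho>0 \<rho> t
  proof -
    have \<rho>: "continuous_L2 \<rho>" using sol by (simp add: weak_solution_def)
    have v: "m \<le> velocity lam \<rho> s" if "s \<in> {0..t}" for s
    proof -
      have "\<bar>total_mass \<rho> s\<bar> \<le> R"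
        using weak_solution_mass_bound[OF sol lam pos \<rho>0(1), of s] that \<kappa> \<rho>0(2) by auto
      then show ?thesis using w by (auto simp: m_def velocity_def abs_le_iff)
    qed
    have \<xi>: "m * t \<le> displacement lam \<rho> t"
    proof -
      have "integral {0..t} (\<lambda>_. m) \<le> displacement lam \<rho> t"
        unfolding displacement_def
        by (intro integral_le integrable_continuous_interval continuous_on_velocity lam \<rho> continuous_intros v)
      then show ?thesis using t by (simp add: mult.commute)
    qed
    \<comment> \<open>A particle inside at time \<open>t\<close> has passed the boundary more than \<open>m * t - 1\<close> times.\<close>
    define q where "q = \<kappa> powr (m * t - 1)"
    have q: "\<bar>k\<bar> ^ j \<le> q" if "real j > displacement lam \<rho> t - 1" for j
    proof -
      have "\<bar>k\<bar> ^ j \<le> \<kappa> ^ j" using \<kappa> by (intro power_mono) auto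
      also have "\<dots> = \<kappa> powr real j" using \<kappa> by (simp add: powr_realpow)
      also have "\<dots> \<le> q" unfolding q_def using \<kappa> \<xi> that by (intro powr_mono') auto
      finally show ?thesis .
    qed
    have "q = C * exp (- \<alpha> * t)"
      using \<kappa> by (simp add: q_def C_def \<alpha>_def powr_def exp_diff exp_minus left_diff_distrib algebra_simps field_simps)
    moreover have "L2_norm_on {0<..<1} (\<rho> t) \<le> q * L2_norm_on {0<..<1} \<rho>0"
    proof -
      have "(LINT x:{0<..<1}|lebesgue. \<bar>\<rho> t x\<bar> ^ 2) \<le> q ^ 2 * (LINT x:{0<..<1}|lebesgue. \<bar>\<rho>0 x\<bar> ^ 2)"
        using \<rho>0(1) q
        by (intro weak_solution_power_bound[OF sol lam pos \<rho>0(1) t]) (auto simp: in_L2_def q_def)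
      then have "sqrt (LINT x:{0<..<1}|lebesgue. (\<rho> t x)\<^sup>2) \<le> sqrt (q\<^sup>2 * (LINT x:{0<..<1}|lebesgue. (\<rho>0 x)\<^sup>2))"
        by simp
      then show ?thesis by (simp add: L2_norm_on_def real_sqrt_mult q_def)
    qed
    ultimately show ?thesis by simp
  qed
  with C \<alpha> show "\<exists>C>0. \<exists>\<alpha>>0.
       \<forall>\<rho>0. in_L2 {0<..<1} \<rho>0 \<longrightarrow> L1_norm_on {0<..<1} \<rho>0 \<le> R \<longrightarrow>
         (\<forall>\<rho>. weak_solution lam k \<rho>0 \<rho> \<longrightarrow>
           (\<forall>t\<ge>0. L2_norm_on {0<..<1} (\<rho> t)
                    \<le> C * exp (- \<alpha> * t) * L2_norm_on {0<..<1} \<rho>0))"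
    by blast
qed

end
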